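(* Let $a,b\in\mathbf{Q}^\times$. For there to exist $x,y\in\mathbf{Q}$ such that $ax^2+by^2=1$, it is necessary and sufficient that $(a,b)_v=1$ for every place $v$ of $\mathbf{Q}$ (that is, for $v$ every prime number and $v=\infty$).
   Context: The symbols $(a,b)_v\in\{1,-1\}$ for $a,b\in\mathbf{Q}^\times$ are defined by the following explicit formulas. For a prime $p$, let $\mathbf{Z}_{(p)}\subset\mathbf{Q}$ be the localization of $\mathbf{Z}$ at $p$. Every $x\in\mathbf{Q}^\times$ is uniquely $x=p^{v_p(x)}u_x$ with $v_p(x)\in\mathbf{Z}$ and $u_x\in\mathbf{Z}_{(p)}^\times$. Put $$t_{a,b}=(-1)^{v_p(a)v_p(b)}u_a^{v_p(b)}u_b^{-v_p(a)}\in\mathbf{Z}_{(p)}^\times.$$ - If $p$ is odd, $(a,b)_p=\lambda_p(t_{a,b})$, where for $u\in\mathbf{Z}_{(p)}^\times$, $\lambda_p(u)=1$ if the image of $u$ in $\mathbf{F}_p^\times$ is a square and $\lambda_p(u)=-1$ otherwise. - If $p=2$, $(a,b)_2=(-1)^{\varepsilon_4(u_a)\varepsilon_4(u_b)+\varepsilon_8(t_{a,b})}$, where for $u\in\mathbf{Z}_{(2)}^\times$, $\varepsilon_4(u)\in\mathbf{F}_2$ is $0$ if $u\equiv 1\pmod 4$ and $1$ if $u\equiv -1\pmod 4$, and $\varepsilon_8(u)\in\mathbf{F}_2$ is $0$ if $u\equiv\pm1\pmod 8$ and $1$ if $u\equiv\pm5\pmod 8$. - For $v=\infty$, $(a,b)_\infty=1$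 if $a>0$ or $b>0$, and $(a,b)_\infty=-1$ if $a<0$ and $b<0$. *)

theory Defs
  imports Complex_Main "HOL-Number_Theory.Number_Theory"
begin

definition local_ring :: "nat \<Rightarrow> rat set" where
  "local_ring p = {of_int m / of_int n | m n :: int. \<not> int p dvd n}"

definition local_units :: "nat \<Rightarrow> rat set" where
  "local_units p = {u \<in> local_ring p. \<exists>w \<in> local_ring p. u * w = 1}"

text \<open>Congruence modulo the ideal generated by \<open>m\<close> in the localization of the integers at \<open>p\<close>.
  For \<open>m\<close> a power of a prime \<open>p\<close>, the quotient by this ideal is canonically the ring of
  integers modulo \<open>m\<close>.\<close>

definition local_cong :: "nat \<Rightarrow> int \<Rightarrow> rat \<Rightarrow> rat \<Rightarrow> bool" where
  "local_cong p m u w \<longleftrightarrow> (\<exists>z \<in> local_ring p. u - w = of_int m * z)"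

definition val :: "nat \<Rightarrow> rat \<Rightarrow> int" where
  "val p x = (THE k. \<exists>u \<in> local_units p. x = of_nat p powi k * u)"

definition unit_part :: "nat \<Rightarrow> rat \<Rightarrow> rat" where
  "unit_part p x = (THE u. u \<in> local_units p \<and> x = of_nat p powi val p x * u)"

definition tame :: "nat \<Rightarrow> rat \<Rightarrow> rat \<Rightarrow> rat" where
  "tame p a b = (- 1) powi (val p a * val p b)
     * unit_part p a powi val p b * unit_part p b powi (- val p a)"

text \<open>The integer \<open>r\<close> below represents the image of \<open>u\<close> in the field with \<open>p\<close> elements.\<close>

definition lambda :: "nat \<Rightarrow> rat \<Rightarrow> int" where
  "lambda p u = (if \<exists>r. local_cong p (int p) u (of_int r) \<and> QuadRes (int p) r then 1 else - 1)"

text \<open>The next two functions are only used on units at 2, and their values, elements of the field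
  with two elements, only as exponents of \<open>-1\<close>.  The \<open>else\<close> branches are the classes of \<open>-1\<close>
  modulo 4 and of \<open>5\<close> and \<open>-5\<close> modulo 8; see \<open>local_units_2_cong_4\<close> and
  \<open>local_units_2_cong_8\<close>.\<close>

definition eps4 :: "rat \<Rightarrow> nat" where
  "eps4 u = (if local_cong 2 4 u 1 then 0 else 1)"

definition eps8 :: "rat \<Rightarrow> nat" where
  "eps8 u = (if local_cong 2 8 u 1 \<or> local_cong 2 8 u (- 1) then 0 else 1)"

datatype place = Finite_Place nat | Infinite_Place

definition places_rat :: "place set" where
  "places_rat = insert Infinite_Place {Finite_Place p | p. prime p}"

fun hilbert_symbol :: "place \<Rightarrow> rat \<Rightarrow> rat \<Rightarrow> int" where
  "hilbert_symbol (Finite_Place p) a b =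
     (if p = 2 then (- 1) ^ (eps4 (unit_part 2 a) * eps4 (unit_part 2 b) + eps8 (tame 2 a b))
      else lambda p (tame p a b))"
| "hilbert_symbol Infinite_Place a b = (if a > 0 \<or> b > 0 then 1 else - 1)"


subsection \<open>Well-definedness\<close>

lemma local_units_iff:
  assumes "prime p"
  shows "u \<in> local_units p \<longleftrightarrow>
    (\<exists>m n :: int. u = of_int m / of_int n \<and> \<not> int p dvd m \<and> \<not> int p dvd n)"
proof
  assume "u \<in> local_units p"
  then obtain m n m' n' :: int where
    *: "u = of_int m / of_int n" "\<not> int p dvd n" "\<not> int p dvd n'"
       "u * (of_int m' / of_int n') = 1"
    unfolding local_units_def local_ring_def by blast
  then have "n \<noteq> 0" "n' \<noteq> 0" by auto
  then have "(of_int (m * m') :: rat) = of_int (n * n')"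
    using * by (simp add: field_simps)
  then have "m * m' = n * n'" by (simp only: of_int_eq_iff)
  moreover have "\<not> int p dvd n * n'"
    using * assms by (simp add: prime_dvd_mult_iff)
  ultimately have "\<not> int p dvd m" by (metis dvd_mult2)
  then show "\<exists>m n :: int. u = of_int m / of_int n \<and> \<not> int p dvd m \<and> \<not> int p dvd n"
    using * by blast
next
  assume "\<exists>m n :: int. u = of_int m / of_int n \<and> \<not> int p dvd m \<and> \<not> int p dvd n"
  then obtain m n :: int where *: "u = of_int m / of_int n" "\<not> int p dvd m" "\<not> int p dvd n"
    by blast
  then have "m \<noteq> 0" "n \<noteq> 0" by auto
  then have "u * (of_int n / of_int m) = 1" using * by simp
  then show "u \<in> local_units p"
    unfolding local_units_def local_ring_def using * by blast
qed

lemma decomposition_exists: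
  assumes "prime p" "x \<noteq> 0"
  shows "\<exists>k. \<exists>u \<in> local_units p. x = of_nat p powi k * u"
proof -
  obtain a b :: int where x: "x = of_int a / of_int b" "b \<noteq> 0"
    by (metis Fract_of_int_quotient Rat_cases less_irrefl)
  with assms have "a \<noteq> 0" by auto
  have np: "\<not> is_unit (int p)" using assms(1) prime_gt_1_nat[of p] by simp
  obtain a' where a: "a = int p ^ multiplicity (int p) a * a'" "\<not> int p dvd a'"
    using multiplicity_decompose'[OF \<open>a \<noteq> 0\<close> np] by blast
  obtain b' where b: "b = int p ^ multiplicity (int p) b * b'" "\<not> int p dvd b'"
    using multiplicity_decompose'[OF \<open>b \<noteq> 0\<close> np] by blast
  define i j where "i = multiplicity (int p) a" and "j = multiplicity (int p) b"
  have p0: "(of_nat p :: rat) \<noteq> 0" using assms by auto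
  have ra: "(of_int a :: rat) = of_nat p ^ i * of_int a'"
    by (subst a(1)) (simp add: i_def)
  have rb: "(of_int b :: rat) = of_nat p ^ j * of_int b'"
    by (subst b(1)) (simp add: j_def)
  have "x = of_nat p powi (int i - int j) * (of_int a' / of_int b')"
    using p0 unfolding x(1) ra rb by (simp add: power_int_diff)
  moreover have "of_int a' / of_int b' \<in> local_units p"
    using a b assms local_units_iff by blast
  ultimately show ?thesis by blast
qed

lemma decomposition_unique_exp:
  assumes "prime p" "u \<in> local_units p" "w \<in> local_units p"
    and "of_nat p powi k * u = of_nat p powi l * w"
  shows "k = l"
proof -
  have aux: False
    if h: "k < l" "u \<in> local_units p" "w \<in> local_units p"
      "of_nat p powi k * u = of_nat p powi l * w" for k l u w
  proof -
    have p0: "(of_nat p :: rat) \<noteq> 0" using assms by auto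
    define d where "d = nat (l - k)"
    have d: "d > 0" "l = k + int d" using that by (auto simp: d_def)
    have u: "u = of_nat p ^ d * w"
      using h(4) p0 unfolding d(2) by (simp add: power_int_add)
    obtain m n :: int where m: "u = of_int m / of_int n" "\<not> int p dvd m" "\<not> int p dvd n"
      using h(2) unfolding local_units_iff[OF assms(1)] by blast
    obtain m' n' :: int where n': "w = of_int m' / of_int n'" "\<not> int p dvd n'"
      using h(3) unfolding local_units_iff[OF assms(1)] by blast
    have nz: "(of_int n :: rat) \<noteq> 0" "(of_int n' :: rat) \<noteq> 0" using m n' by auto
    have "(of_int m :: rat) / of_int n = of_nat p ^ d * of_int m' / of_int n'"
      using u unfolding m(1) n'(1) by simp
    then have "(of_int m :: rat) * of_int n' = of_nat p ^ d * of_int m' * of_int n"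
      by (simp add: frac_eq_eq[OF nz])
    then have "(of_int (m * n') :: rat) = of_int (int p ^ d * m' * n)" by simp
    then have "m * n' = int p ^ d * m' * n" by (simp only: of_int_eq_iff)
    then have "int p dvd m * n'" using d(1) by (simp add: dvd_power)
    with m n' assms(1) show False by (simp add: prime_dvd_mult_iff)
  qed
  show ?thesis
    using aux[of k l u w] aux[of l k w u] assms by (metis linorder_neqE)
qed

lemma val_unit_part:
  assumes "prime p" "x \<noteq> 0"
  shows "unit_part p x \<in> local_units p" "x = of_nat p powi val p x * unit_part p x"
proof -
  have p0: "(of_nat p :: rat) \<noteq> 0" using assms by auto
  have "\<exists>!k. \<exists>u \<in> local_units p. x = of_nat p powi k * u"
    using decomposition_exists[OF assms] decomposition_unique_exp[OF assms(1)] by metis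
  then have "\<exists>u \<in> local_units p. x = of_nat p powi val p x * u"
    unfolding val_def by (rule theI')
  then obtain u where u: "u \<in> local_units p" "x = of_nat p powi val p x * u" by blast
  have "(of_nat p :: rat) powi val p x \<noteq> 0" using p0 by simp
  then have "w = u" if "x = of_nat p powi val p x * w" for w
    using that u(2) by (metis mult_left_cancel)
  then have "\<exists>!u. u \<in> local_units p \<and> x = of_nat p powi val p x * u"
    using u by blast
  then have "unit_part p x \<in> local_units p \<and> x = of_nat p powi val p x * unit_part p x"
    unfolding unit_part_def by (rule theI')
  then show "unit_part p x \<in> local_units p" "x = of_nat p powi val p x * unit_part p x"
    by auto
qed

lemma local_cong_quotient:
  assumes "prime p" "\<not> int p dvd n" "m dvd k - r * n"
  shows "local_cong p m (of_int k / of_int n) (of_int r)"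
proof -
  obtain c where c: "k - r * n = m * c" using assms by blast
  have "n \<noteq> 0" using assms by auto
  then have "of_int k / of_int n - (of_int r :: rat) = of_int (k - r * n) / of_int n"
    by (simp add: field_simps)
  also have "\<dots> = of_int m * (of_int c / of_int n)" by (simp add: c)
  finally show ?thesis
    unfolding local_cong_def local_ring_def using assms by blast
qed

lemma local_units_2_cong_4:
  assumes "u \<in> local_units 2"
  shows "local_cong 2 4 u 1 \<or> local_cong 2 4 u (- 1)"
proof -
  obtain m n :: int where *: "u = of_int m / of_int n" "\<not> 2 dvd m" "\<not> 2 dvd n"
    using assms local_units_iff[of 2 u] by auto
  then have "4 dvd m - 1 * n \<or> 4 dvd m - (- 1) * n" by presburger
  then show ?thesis
    using local_cong_quotient[of 2 n 4 m 1] local_cong_quotient[of 2 n 4 m "- 1"] * by auto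
qed

lemma local_units_2_cong_8:
  assumes "u \<in> local_units 2"
  shows "local_cong 2 8 u 1 \<or> local_cong 2 8 u (- 1) \<or> local_cong 2 8 u 5 \<or> local_cong 2 8 u (- 5)"
proof -
  obtain m n :: int where *: "u = of_int m / of_int n" "\<not> 2 dvd m" "\<not> 2 dvd n"
    using assms local_units_iff[of 2 u] by auto
  then have "8 dvd m - 1 * n \<or> 8 dvd m - (- 1) * n \<or> 8 dvd m - 5 * n \<or> 8 dvd m - (- 5) * n"
    by presburger
  then show ?thesis
    using local_cong_quotient[of 2 n 8 m 1] local_cong_quotient[of 2 n 8 m "- 1"]
      local_cong_quotient[of 2 n 8 m 5] local_cong_quotient[of 2 n 8 m "- 5"] * by auto
qed

end

theory Submission
  imports Defs "HOL-Computational_Algebra.Squarefree"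
begin

text \<open>
  At each place the symbol is symmetric, bilinear and satisfies the Steinberg relation
  \<open>(a, 1 - a) = 1\<close>. A solution of \<open>a x\<^sup>2 + b y\<^sup>2 = 1\<close> exhibits \<open>(a, b)\<close> as
  \<open>(A, 1 - A)\<close> up to square factors, which gives necessity.

  For sufficiency one may take \<open>a\<close> and \<open>b\<close> to be integers with \<open>b\<close> squarefree and
  \<open>\<bar>a\<bar> \<le> \<bar>b\<bar>\<close>. The symbols at the odd primes dividing \<open>b\<close> force \<open>a\<close> to be a square modulo
  \<open>b\<close>, say \<open>t\<^sup>2 - a = b c\<close> with \<open>\<bar>t\<bar> \<le> \<bar>b\<bar> / 2\<close>. As \<open>b c\<close> is a norm from the extension by
  the square root of \<open>a\<close>, the symbols and the solvability for \<open>(a, b)\<close> and \<open>(a, c)\<close> agree, and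
  \<open>\<bar>c\<bar> < \<bar>b\<bar>\<close> unless \<open>\<bar>b\<bar> = 1\<close>. There the place at infinity excludes \<open>a = b = -1\<close>.
  Quadratic reciprocity is not needed because every place is among the hypotheses.
\<close>

section \<open>Values represented by binary forms\<close>

text \<open>Dividing by \<open>y\<^sup>2\<close> gives the norm form. If \<open>y = 0\<close>, then
  \<open>a\<close> is a nonzero square, so \<open>u\<^sup>2 - a * v\<^sup>2\<close> is hyperbolic
  and takes every value.\<close>

lemma norm_form_if_represents_one:
  fixes a b x y :: rat
  assumes "a * x\<^sup>2 + b * y\<^sup>2 = 1"
  shows "\<exists>u v. b = u\<^sup>2 - a * v\<^sup>2"
proof (cases "y = 0")
  case True
  then have "a * x\<^sup>2 = 1" using assms by simp
  \<comment> \<open>Every \<open>b\<close> is the difference of the squares of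
    \<open>(b + 1) / 2\<close> and \<open>(b - 1) / 2\<close>; the factor
    \<open>a * x\<^sup>2 = 1\<close> is inserted into the second square.\<close>
  then have "((b + 1) / 2)\<^sup>2 - a * (x * ((b - 1) / 2))\<^sup>2 = ((b + 1) / 2)\<^sup>2 - ((b - 1) / 2)\<^sup>2"
    by (simp only: power_mult_distrib mult_1 flip: mult.assoc)
  also have "\<dots> = b" by (simp add: power2_eq_square field_simps)
  finally show ?thesis by metis
next
  case False
  then have "b = (1 / y)\<^sup>2 - a * (x / y)\<^sup>2"
    using assms by (simp add: power_divide field_simps)
  then show ?thesis by blast
qed

text \<open>Dividing by \<open>u\<^sup>2\<close> gives the solution. If \<open>u = 0\<close>, then
  \<open>b = - a * v\<^sup>2\<close> and the form \<open>a * x\<^sup>2 + b * y\<^sup>2\<close> is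
  itself hyperbolic.\<close>

lemma represents_one_if_norm_form:
  fixes a b u v :: rat
  assumes "a \<noteq> 0" "b \<noteq> 0" "b = u\<^sup>2 - a * v\<^sup>2"
  shows "\<exists>x y. a * x\<^sup>2 + b * y\<^sup>2 = 1"
proof (cases "u = 0")
  case True
  then have b: "b = - a * v\<^sup>2" and "v \<noteq> 0" using assms by auto
  \<comment> \<open>The witnesses come from writing \<open>1 / a\<close> as the difference of the
    squares of \<open>(1 + 1 / a) / 2\<close> and \<open>(1 - 1 / a) / 2\<close>.\<close>
  have "a * ((1 + 1 / a) / 2)\<^sup>2 + b * ((1 - 1 / a) / (2 * v))\<^sup>2 = 1"
    using \<open>a \<noteq> 0\<close> \<open>v \<noteq> 0\<close> unfolding b by (simp add: power2_eq_square field_simps)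
  then show ?thesis by blast
next
  case False
  then have "a * (v / u)\<^sup>2 + b * (1 / u)\<^sup>2 = 1"
    using assms(3) by (simp add: power_divide field_simps)
  then show ?thesis by blast
qed

text \<open>Values of the norm form are closed under products by Brahmagupta's identity. As
  \<open>b\<close> and \<open>b * c\<close> are both values, so is
  \<open>c = (b * c) * b / b\<^sup>2\<close>.\<close>

lemma represents_one_cancel:
  fixes a b c :: rat
  assumes "a \<noteq> 0" "b \<noteq> 0" "c \<noteq> 0"
    and "\<exists>x y. a * x\<^sup>2 + b * y\<^sup>2 = 1"
    and "b * c = s\<^sup>2 - a * t\<^sup>2"
  shows "\<exists>x y. a * x\<^sup>2 + c * y\<^sup>2 = 1"
proof -
  obtain u v where b: "b = u\<^sup>2 - a * v\<^sup>2"
    using assms(4) norm_form_if_represents_one by blast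
  have "c * b\<^sup>2 = (u * s + a * v * t)\<^sup>2 - a * (u * t + v * s)\<^sup>2"
  proof -
    have "c * b\<^sup>2 = (u\<^sup>2 - a * v\<^sup>2) * (s\<^sup>2 - a * t\<^sup>2)"
      using assms(5) b by (simp add: power2_eq_square mult_ac)
    then show ?thesis by (simp add: power2_eq_square algebra_simps)
  qed
  then have "c = ((u * s + a * v * t) / b)\<^sup>2 - a * ((u * t + v * s) / b)\<^sup>2"
    using assms(2) by (simp add: power_divide field_simps)
  then show ?thesis using represents_one_if_norm_form[OF assms(1,3)] by blast
qed

lemma represents_one_swap:
  fixes a b :: rat
  assumes "\<exists>x y. a * x\<^sup>2 + b * y\<^sup>2 = 1"
  shows "\<exists>x y. b * x\<^sup>2 + a * y\<^sup>2 = 1"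
  using assms by (metis add.commute)

lemma represents_one_square_factor:
  fixes a b c :: rat
  assumes "c \<noteq> 0" "\<exists>x y. a * x\<^sup>2 + b * y\<^sup>2 = 1"
  shows "\<exists>x y. a * x\<^sup>2 + (b * c\<^sup>2) * y\<^sup>2 = 1"
proof -
  obtain x y where "a * x\<^sup>2 + b * y\<^sup>2 = 1" using assms(2) by blast
  then have "a * x\<^sup>2 + (b * c\<^sup>2) * (y / c)\<^sup>2 = 1" using assms(1) by (simp add: power_divide)
  then show ?thesis by blast
qed

section \<open>Symmetric bilinear pairings with values in signs\<close>

text \<open>These laws are isolated so that the symbols at all places share the same arguments.
  Multiplicativity on the left follows by symmetry.\<close>

locale sign_pairing =
  fixes h :: "rat \<Rightarrow> rat \<Rightarrow> int"
  assumes sign: "a \<noteq> 0 \<Longrightarrow> b \<noteq> 0 \<Longrightarrow> h a b = 1 \<or> h a b = - 1"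
    and commute: "a \<noteq> 0 \<Longrightarrow> b \<noteq> 0 \<Longrightarrow> h a b = h b a"
    and mult_right: "a \<noteq> 0 \<Longrightarrow> b \<noteq> 0 \<Longrightarrow> c \<noteq> 0 \<Longrightarrow> h a (b * c) = h a b * h a c"
begin

lemma mult_self: "a \<noteq> 0 \<Longrightarrow> b \<noteq> 0 \<Longrightarrow> h a b * h a b = 1"
  using sign[of a b] by auto

lemma square_right: "a \<noteq> 0 \<Longrightarrow> c \<noteq> 0 \<Longrightarrow> h a (c\<^sup>2) = 1"
  by (simp add: power2_eq_square mult_right mult_self)

lemma mult_square_right: "a \<noteq> 0 \<Longrightarrow> b \<noteq> 0 \<Longrightarrow> c \<noteq> 0 \<Longrightarrow> h a (b * c\<^sup>2) = h a b"
  by (simp add: mult_right square_right)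

lemma mult_square_left: "a \<noteq> 0 \<Longrightarrow> b \<noteq> 0 \<Longrightarrow> c \<noteq> 0 \<Longrightarrow> h (a * c\<^sup>2) b = h a b"
  using commute mult_square_right by simp

lemma inverse_right: "a \<noteq> 0 \<Longrightarrow> b \<noteq> 0 \<Longrightarrow> h a (1 / b) = h a b"
  using mult_square_right[of a b "1 / b"] by (simp add: power2_eq_square)

lemma one_right: "a \<noteq> 0 \<Longrightarrow> h a 1 = 1"
  using square_right[of a 1] by simp

end

locale steinberg_pairing = sign_pairing +
  assumes steinberg: "a \<noteq> 0 \<Longrightarrow> a \<noteq> 1 \<Longrightarrow> h a (1 - a) = 1"
begin

text \<open>Square factors do not change the symbol, so the Steinberg relation for
  \<open>a * x\<^sup>2\<close> applies. It says nothing when \<open>x\<close> or \<open>y\<close>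
  vanishes, but then \<open>b\<close> or \<open>a\<close> is a square.\<close>

lemma one_if_represents_one:
  assumes "a \<noteq> 0" "b \<noteq> 0" "a * x\<^sup>2 + b * y\<^sup>2 = 1"
  shows "h a b = 1"
proof -
  consider "x = 0" "y \<noteq> 0" | "x \<noteq> 0" "y = 0" | "x \<noteq> 0" "y \<noteq> 0"
    using assms(3) by fastforce
  then show ?thesis
  proof cases
    case 1
    then have "b * y\<^sup>2 = 1" using assms by simp
    then show ?thesis using mult_square_right[of a b y] one_right[of a] assms 1 by simp
  next
    case 2
    then have "a * x\<^sup>2 = 1" using assms by simp
    then show ?thesis
      using mult_square_right[of b a x] one_right[of b] commute[of a b] assms 2 by simp
  next
    case 3
    have "1 - a * x\<^sup>2 = b * y\<^sup>2" using assms(3) by simp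
    moreover have "a * x\<^sup>2 \<noteq> 1" using calculation 3 assms by auto
    ultimately have "h (a * x\<^sup>2) (b * y\<^sup>2) = 1"
      using steinberg[of "a * x\<^sup>2"] 3 assms(1) by simp
    then show ?thesis
      using mult_square_right[of "a * x\<^sup>2" b y] mult_square_left[of a b x] assms 3 by simp
  qed
qed

text \<open>A nonzero value of the norm form of \<open>a\<close> pairs trivially with
  \<open>a\<close>, so the signs of \<open>b\<close> and \<open>c\<close> have product 1.\<close>

lemma cancel_norm_form:
  assumes "a \<noteq> 0" "b \<noteq> 0" "c \<noteq> 0" "b * c = u\<^sup>2 - a * v\<^sup>2"
  shows "h a c = h a b"
proof -
  have "b * c \<noteq> 0" using assms(2,3) by simp
  then obtain x y where "a * x\<^sup>2 + (b * c) * y\<^sup>2 = 1"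
    using represents_one_if_norm_form assms(1,4) by blast
  then have "h a (b * c) = 1"
    using one_if_represents_one assms(1) \<open>b * c \<noteq> 0\<close> by blast
  then have "h a b * h a c = 1" using mult_right assms(1-3) by simp
  then show ?thesis using sign[of a b] assms by auto
qed

end

section \<open>Local rings, valuations and unit parts\<close>

context
  fixes p :: nat
  assumes p: "prime p"
begin

section \<open>Closure properties of the localization and its units\<close>

lemma local_ringI: "\<not> int p dvd n \<Longrightarrow> of_int m / of_int n \<in> local_ring p"
  unfolding local_ring_def by blast

lemma local_ringE:
  assumes "z \<in> local_ring p"
  obtains m n where "z = of_int m / of_int n" "\<not> int p dvd n" "n \<noteq> 0"
  using assms unfolding local_ring_def by fastforce

lemma of_int_in_local_ring: "of_int m \<in> local_ring p"
  using local_ringI[of 1 m] p by (metis div_by_1 of_int_1 int_dvd_int_iff of_nat_1 not_prime_1 nat_dvd_1_iff_1)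

lemma local_ring_mult:
  assumes "x \<in> local_ring p" "y \<in> local_ring p"
  shows "x * y \<in> local_ring p"
proof -
  obtain m n where x: "x = of_int m / of_int n" "\<not> int p dvd n" "n \<noteq> 0"
    using assms(1) by (rule local_ringE)
  obtain k l where y: "y = of_int k / of_int l" "\<not> int p dvd l" "l \<noteq> 0"
    using assms(2) by (rule local_ringE)
  have "x * y = of_int (m * k) / of_int (n * l)" using x y by simp
  moreover have "\<not> int p dvd n * l" using x y p by (simp add: prime_dvd_mult_iff)
  ultimately show ?thesis using local_ringI by metis
qed

lemma local_ring_add:
  assumes "x \<in> local_ring p" "y \<in> local_ring p"
  shows "x + y \<in> local_ring p"
proof -
  obtain m n where x: "x = of_int m / of_int n" "\<not> int p dvd n" "n \<noteq> 0"
    using assms(1) by (rule local_ringE)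
  obtain k l where y: "y = of_int k / of_int l" "\<not> int p dvd l" "l \<noteq> 0"
    using assms(2) by (rule local_ringE)
  have "x + y = of_int (m * l + k * n) / of_int (n * l)" using x y by (simp add: field_simps)
  moreover have "\<not> int p dvd n * l" using x y p by (simp add: prime_dvd_mult_iff)
  ultimately show ?thesis using local_ringI by metis
qed

lemma local_ring_minus: "x \<in> local_ring p \<Longrightarrow> - x \<in> local_ring p"
  using local_ring_mult[of "- 1" x] of_int_in_local_ring[of "- 1"] by simp

lemma local_units_subset: "u \<in> local_units p \<Longrightarrow> u \<in> local_ring p"
  by (simp add: local_units_def)

lemma local_units_nonzero: "u \<in> local_units p \<Longrightarrow> u \<noteq> 0"
  by (auto simp: local_units_def)

lemma local_units_mult:
  assumes "u \<in> local_units p" "w \<in> local_units p"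
  shows "u * w \<in> local_units p"
proof -
  obtain u' w' where *: "u' \<in> local_ring p" "w' \<in> local_ring p" "u * u' = 1" "w * w' = 1"
    using assms unfolding local_units_def by blast
  then have "(u * w) * (u' * w') = 1" by (metis mult.assoc mult.commute mult_1)
  then show ?thesis
    using * assms local_ring_mult unfolding local_units_def by blast
qed

lemma local_units_inverse:
  assumes "u \<in> local_units p"
  shows "inverse u \<in> local_units p"
proof -
  obtain u' where *: "u' \<in> local_ring p" "u * u' = 1"
    using assms unfolding local_units_def by blast
  then have "u' = inverse u" by (metis inverse_unique)
  with * assms show ?thesis unfolding local_units_def by (auto simp: mult.commute)
qed

lemma of_int_in_local_units: "\<not> int p dvd m \<Longrightarrow> of_int m \<in> local_units p"
  using local_units_iff[OF p, of "of_int m"] p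
  by (metis div_by_1 of_int_1 int_dvd_int_iff of_nat_1 not_prime_1 nat_dvd_1_iff_1)

lemma one_in_local_units: "1 \<in> local_units p"
  using of_int_in_local_units[of 1] prime_gt_1_nat[OF p] by simp

lemma local_units_minus: "u \<in> local_units p \<Longrightarrow> - u \<in> local_units p"
  using local_units_mult[of "- 1" u] of_int_in_local_units[of "- 1"] prime_gt_1_nat[OF p] by simp

lemma local_units_powi: "u \<in> local_units p \<Longrightarrow> u powi k \<in> local_units p"
proof -
  assume u: "u \<in> local_units p"
  have *: "w ^ n \<in> local_units p" if "w \<in> local_units p" for w n
    by (induction n) (auto simp: that local_units_mult one_in_local_units)
  show ?thesis
    unfolding power_int_def using *[OF u] *[OF local_units_inverse[OF u]] by simp
qed

section \<open>Congruences in the localization and integer representatives\<close>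

lemma local_cong_mult:
  assumes "local_cong p m u w" "local_cong p m u' w'" "u' \<in> local_ring p" "w \<in> local_ring p"
  shows "local_cong p m (u * u') (w * w')"
proof -
  obtain z z' where *: "z \<in> local_ring p" "z' \<in> local_ring p"
    "u - w = of_int m * z" "u' - w' = of_int m * z'"
    using assms unfolding local_cong_def by blast
  have "u * u' - w * w' = (u - w) * u' + w * (u' - w')" by (simp add: algebra_simps)
  also have "\<dots> = of_int m * (z * u' + w * z')" using * by (simp add: algebra_simps)
  finally show ?thesis
    using * assms unfolding local_cong_def by (blast intro: local_ring_mult local_ring_add)
qed

lemma local_cong_trans:
  assumes "local_cong p m u v" "local_cong p m v w"
  shows "local_cong p m u w"
proof -
  obtain z z' where *: "z \<in> local_ring p" "z' \<in> local_ring p"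
    "u - v = of_int m * z" "v - w = of_int m * z'"
    using assms unfolding local_cong_def by blast
  then have "u - w = of_int m * (z + z')" by (simp add: algebra_simps)
  then show ?thesis using * unfolding local_cong_def by (blast intro: local_ring_add)
qed

lemma local_cong_minus:
  assumes "local_cong p m u w"
  shows "local_cong p m (- u) (- w)" "local_cong p m w u"
proof -
  obtain z where *: "z \<in> local_ring p" "u - w = of_int m * z"
    using assms unfolding local_cong_def by blast
  then have "- z \<in> local_ring p" "- u - - w = of_int m * - z" "w - u = of_int m * - z"
    using local_ring_minus by (auto simp: algebra_simps)
  then show "local_cong p m (- u) (- w)" "local_cong p m w u"
    unfolding local_cong_def by blast+
qed

lemma local_cong_dvd:
  assumes "local_cong p m u w" "m' dvd m"
  shows "local_cong p m' u w"
proof -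
  obtain z where *: "z \<in> local_ring p" "u - w = of_int m * z"
    using assms unfolding local_cong_def by blast
  obtain k where k: "m = m' * k" using assms(2) by blast
  have "u - w = of_int m' * (of_int k * z)" using * k by simp
  then show ?thesis
    using * unfolding local_cong_def by (blast intro: local_ring_mult of_int_in_local_ring)
qed

text \<open>A denominator prime to \<open>p\<close> is prime to \<open>m\<close> and can be
  cancelled, so the local congruence restricts to the usual one on integers.\<close>

lemma local_cong_of_int_iff:
  assumes "m = int p ^ k"
  shows "local_cong p m (of_int r) (of_int s) \<longleftrightarrow> m dvd r - s"
proof
  assume "local_cong p m (of_int r) (of_int s)"
  then obtain z where z: "z \<in> local_ring p" "of_int r - of_int s = of_int m * z"
    unfolding local_cong_def by blast
  obtain c n where c: "z = of_int c / of_int n" "\<not> int p dvd n" "n \<noteq> 0"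
    using z(1) by (rule local_ringE)
  have "(of_int ((r - s) * n) :: rat) = of_int (m * c)"
    using z(2) c by (simp add: field_simps)
  then have "(r - s) * n = m * c" by (simp only: of_int_eq_iff)
  then have "m dvd (r - s) * n" by simp
  moreover have "coprime m n"
    using c p assms by (simp add: prime_imp_coprime)
  ultimately show "m dvd r - s" by (simp add: coprime_dvd_mult_left_iff)
next
  assume "m dvd r - s"
  then obtain c where "r - s = m * c" by blast
  then have "of_int r - of_int s = (of_int m * of_int c :: rat)"
    by (metis of_int_diff of_int_mult)
  then show "local_cong p m (of_int r) (of_int s)"
    unfolding local_cong_def using of_int_in_local_ring by blast
qed

text \<open>The denominator is invertible modulo \<open>m\<close>, so the fraction may be replaced
  by the numerator times an integer inverse.\<close>

lemma local_cong_representative: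
  assumes "m = int p ^ k" "z \<in> local_ring p"
  obtains r where "local_cong p m z (of_int r)"
proof -
  obtain c n where c: "z = of_int c / of_int n" "\<not> int p dvd n" "n \<noteq> 0"
    using assms(2) by (rule local_ringE)
  have "coprime m n"
    using c p assms by (simp add: prime_imp_coprime)
  then have "coprime n m" by (simp add: coprime_commute)
  then obtain x where "[n * x = 1] (mod m)" using cong_solve_coprime_int by blast
  then have "m dvd 1 - n * x" by (metis cong_iff_dvd_diff cong_sym)
  then have "m dvd c * (1 - n * x)" by simp
  then have "m dvd c - (c * x) * n" by (simp add: algebra_simps)
  then show ?thesis using that local_cong_quotient[OF p c(2)] c(1) by blast
qed

text \<open>Representatives of \<open>u\<close> and of \<open>inverse u\<close> multiply to 1 modulo
  \<open>m\<close>, hence modulo \<open>p\<close> because \<open>k > 0\<close>; so \<open>p\<close>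
  cannot divide the first.\<close>

lemma local_units_representative:
  assumes "m = int p ^ k" "k > 0" "u \<in> local_units p"
  obtains r where "local_cong p m u (of_int r)" "\<not> int p dvd r"
proof -
  obtain c n where c: "u = of_int c / of_int n" "\<not> int p dvd c" "\<not> int p dvd n"
    using assms(3) unfolding local_units_iff[OF p] by blast
  obtain r where r: "local_cong p m u (of_int r)"
    using local_cong_representative[OF assms(1) local_units_subset[OF assms(3)]] .
  obtain s where s: "local_cong p m (inverse u) (of_int s)"
    using local_cong_representative[OF assms(1) local_units_subset[OF local_units_inverse[OF assms(3)]]] .
  have "local_cong p m (u * inverse u) (of_int r * of_int s)"
    using r s assms(3) by (intro local_cong_mult local_units_subset[OF local_units_inverse] of_int_in_local_ring)
  then have "local_cong p m (of_int 1) (of_int (r * s))"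
    using local_units_nonzero[OF assms(3)] by simp
  then have "m dvd 1 - r * s" by (simp only: local_cong_of_int_iff[OF assms(1)])
  moreover have "int p dvd m" using assms by simp
  ultimately have "int p dvd 1 - r * s" by (metis dvd_trans)
  then have "\<not> int p dvd r"
    using p by (metis diff_add_cancel dvd_add dvd_mult2 int_dvd_int_iff not_prime_unit of_nat_1)
  then show ?thesis using that r by blast
qed

text \<open>By uniqueness of the decomposition, exhibiting one computes both definite descriptions.
  All later evaluations of \<open>val\<close> and \<open>unit_part\<close> rest on this.\<close>

lemma val_unit_part_eqI:
  assumes "u \<in> local_units p" "x = of_nat p powi k * u"
  shows "val p x = k" "unit_part p x = u"
proof -
  have "(of_nat p :: rat) \<noteq> 0" using p by auto
  then have nz: "(of_nat p :: rat) powi k \<noteq> 0" by simp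
  then have "x \<noteq> 0" using assms local_units_nonzero by simp
  note * = val_unit_part[OF p this]
  show k: "val p x = k"
    using decomposition_unique_exp[OF p *(1) assms(1)] *(2) assms(2) by simp
  then show "unit_part p x = u" using *(2) assms(2) nz by (metis mult_left_cancel)
qed

lemma val_unit_part_local_unit:
  assumes "u \<in> local_units p"
  shows "val p u = 0" "unit_part p u = u"
  using val_unit_part_eqI[OF assms, of u 0] by auto

lemma val_unit_part_mult:
  assumes "x \<noteq> 0" "y \<noteq> 0"
  shows "val p (x * y) = val p x + val p y" "unit_part p (x * y) = unit_part p x * unit_part p y"
proof -
  have p0: "(of_nat p :: rat) \<noteq> 0" using p by auto
  have "x * y = (of_nat p powi val p x * unit_part p x) * (of_nat p powi val p y * unit_part p y)"
    using val_unit_part(2)[OF p] assms by metis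
  then have "x * y = of_nat p powi (val p x + val p y) * (unit_part p x * unit_part p y)"
    using p0 by (simp add: power_int_add mult_ac)
  moreover have "unit_part p x * unit_part p y \<in> local_units p"
    using val_unit_part(1)[OF p] assms local_units_mult by blast
  ultimately show "val p (x * y) = val p x + val p y"
    "unit_part p (x * y) = unit_part p x * unit_part p y"
    using val_unit_part_eqI by blast+
qed

lemma val_unit_part_minus:
  assumes "x \<noteq> 0"
  shows "val p (- x) = val p x" "unit_part p (- x) = - unit_part p x"
proof -
  have "- x = of_nat p powi val p x * (- unit_part p x)"
    using val_unit_part(2)[OF p assms] by simp
  then show "val p (- x) = val p x" "unit_part p (- x) = - unit_part p x"
    using val_unit_part_eqI local_units_minus val_unit_part(1)[OF p assms] by blast+
qed

lemma one_minus_multiple_local_unit: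
  assumes "z \<in> local_ring p"
  shows "1 - of_nat p * z \<in> local_units p"
proof -
  obtain m n where z: "z = of_int m / of_int n" "\<not> int p dvd n" "n \<noteq> 0"
    using assms by (rule local_ringE)
  have "1 - of_nat p * z = of_int (n - int p * m) / of_int n"
    using z by (simp add: field_simps)
  moreover have "\<not> int p dvd n - int p * m"
    using z(2) by (metis dvd_triv_left diff_add_cancel dvd_add)
  ultimately show ?thesis using z(2) local_units_iff[OF p] by blast
qed

section \<open>The tame symbol\<close>

lemma tame_in_local_units:
  assumes "a \<noteq> 0" "b \<noteq> 0"
  shows "tame p a b \<in> local_units p"
  unfolding tame_def
  using assms val_unit_part(1)[OF p]
  by (intro local_units_mult local_units_powi local_units_minus one_in_local_units) auto

lemma tame_mult_right:
  assumes "a \<noteq> 0" "b \<noteq> 0" "c \<noteq> 0"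
  shows "tame p a (b * c) = tame p a b * tame p a c"
proof -
  have "unit_part p a \<noteq> 0"
    using val_unit_part(1)[OF p] local_units_nonzero assms by blast
  then show ?thesis
    using assms
    by (simp add: tame_def val_unit_part_mult power_int_add distrib_left power_int_mult_distrib)
qed

lemma minus_one_powi_mult_self: "(- 1 :: rat) powi n * (- 1) powi n = 1"
  by (simp flip: power_int_mult_distrib)

text \<open>The unit powers are inverse to each other and the common sign is squared. This yields
  the symmetry of the symbols at finite places.\<close>

lemma tame_mult_commute:
  assumes "a \<noteq> 0" "b \<noteq> 0"
  shows "tame p a b * tame p b a = 1"
proof -
  have "unit_part p a \<noteq> 0" "unit_part p b \<noteq> 0"
    using val_unit_part(1)[OF p] local_units_nonzero assms by blast+
  then show ?thesis
    using minus_one_powi_mult_self[of "val p a * val p b"]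
    by (simp add: tame_def power_int_minus field_simps)
qed

lemma tame_minus_self:
  assumes "a \<noteq> 0"
  shows "tame p a (- a) = 1"
proof -
  define u where "u = unit_part p a"
  have u: "u \<noteq> 0"
    using val_unit_part(1)[OF p] local_units_nonzero assms unfolding u_def by blast
  have "tame p a (- a) = (- 1) powi (val p a * val p a) * (u powi val p a * (- u) powi (- val p a))"
    by (simp add: tame_def val_unit_part_minus assms u_def)
  also have "u powi val p a * (- u) powi (- val p a) = (- 1) powi val p a"
    using u by (cases "even (val p a)") (auto simp: power_int_minus)
  \<comment> \<open>The remaining signs have exponents \<open>val p a * val p a\<close> and
    \<open>val p a\<close>, which have the same parity.\<close>
  finally show ?thesis by (cases "even (val p a)") auto
qed

text \<open>Since \<open>a\<close> is divisible by \<open>p\<close> in the localization,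
  \<open>1 - a\<close> is a unit of valuation 0, and the tame symbol keeps only its power.\<close>

lemma positive_val_steinberg:
  assumes "a \<noteq> 0" "val p a > 0"
  shows "1 - a \<in> local_units p"
    "local_cong p (int p ^ nat (val p a)) (1 - a) 1"
    "tame p a (1 - a) = (1 - a) powi (- val p a)"
proof -
  define k where "k = nat (val p a)"
  define u where "u = unit_part p a"
  have k: "val p a = int k" "k > 0" using assms by (auto simp: k_def)
  have u: "u \<in> local_ring p" "a = of_nat p ^ k * u"
    using val_unit_part[OF p assms(1)] k local_units_subset unfolding u_def by auto
  have "a = of_nat p * (of_int (int p ^ (k - 1)) * u)"
    using u(2) k(2) by (cases k) auto
  then show *: "1 - a \<in> local_units p"
    using one_minus_multiple_local_unit u(1) local_ring_mult of_int_in_local_ring by metis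
  have "(1 - a) - 1 = of_int (int p ^ k) * - u" using u(2) by simp
  then show "local_cong p (int p ^ nat (val p a)) (1 - a) 1"
    unfolding local_cong_def k_def[symmetric] using u(1) local_ring_minus by blast
  show "tame p a (1 - a) = (1 - a) powi (- val p a)"
    by (simp add: tame_def val_unit_part_local_unit[OF *])
qed

text \<open>An integer with an integer inverse is a sign and equals that inverse, so
  \<open>f\<close> does not distinguish \<open>u\<close> from \<open>inverse u\<close> and only the
  size of the exponent matters.\<close>

lemma multiplicative_sign_powi:
  fixes f :: "rat \<Rightarrow> int"
  assumes "\<And>u w. u \<in> local_units p \<Longrightarrow> w \<in> local_units p \<Longrightarrow> f (u * w) = f u * f w"
    and "f 1 = 1" and u: "u \<in> local_units p"
  shows "f (u powi k) = f u ^ nat \<bar>k\<bar>"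
proof -
  have pow: "w ^ n \<in> local_units p \<and> f (w ^ n) = f w ^ n" if "w \<in> local_units p" for w n
    by (induction n) (auto simp: assms that local_units_mult one_in_local_units)
  have "f (inverse u) = f u"
  proof -
    have "f u * f (inverse u) = 1"
      using assms(1)[OF u local_units_inverse[OF u]] assms(2) local_units_nonzero[OF u] by simp
    then show ?thesis by (auto simp: zmult_eq_1_iff)
  qed
  then show ?thesis
    using pow[OF u] pow[OF local_units_inverse[OF u]] by (auto simp: power_int_def abs_if)
qed

text \<open>Replacing \<open>a\<close> by \<open>1 / a\<close> and by \<open>1 - a\<close> reduces the Steinberg relation to the cases
  where \<open>a\<close> has positive valuation or both \<open>a\<close> and \<open>1 - a\<close> are units.\<close>

lemma steinberg_pairing_if_val:
  assumes "sign_pairing h"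
    and neg: "\<And>a. a \<noteq> 0 \<Longrightarrow> h a (- a) = 1"
    and pos: "\<And>a. a \<noteq> 0 \<Longrightarrow> a \<noteq> 1 \<Longrightarrow> val p a > 0 \<Longrightarrow> h a (1 - a) = 1"
    and zero: "\<And>a. a \<noteq> 0 \<Longrightarrow> a \<noteq> 1 \<Longrightarrow> val p a = 0 \<Longrightarrow> val p (1 - a) = 0 \<Longrightarrow> h a (1 - a) = 1"
  shows "steinberg_pairing h"
proof -
  interpret sign_pairing h by fact
  have nonneg: "h a (1 - a) = 1" if a: "a \<noteq> 0" "a \<noteq> 1" "val p a \<ge> 0" "val p (1 - a) \<ge> 0" for a
  proof -
    consider "val p a > 0" | "val p (1 - a) > 0" | "val p a = 0" "val p (1 - a) = 0"
      using a by linarith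
    then show ?thesis
      using a pos[of a] pos[of "1 - a"] zero[of a] commute[of a "1 - a"] by cases auto
  qed
  have inv: "h a (1 - a) = 1" if a: "a \<noteq> 0" "a \<noteq> 1" "val p a < 0" for a
  proof -
    have "val p a + val p (1 / a) = 0"
      using val_unit_part_mult(1)[of a "1 / a"] a(1)
        val_unit_part_local_unit(1)[OF one_in_local_units] by simp
    then have "h (1 / a) (1 - 1 / a) = 1" using pos[of "1 / a"] a by simp
    moreover have "h (1 / a) (1 - 1 / a) = h (1 - 1 / a) a"
      using commute[of "1 / a" "1 - 1 / a"] inverse_right[of "1 - 1 / a" a] a by simp
    moreover have "h (1 - 1 / a) a = h a (1 - 1 / a)"
      using commute a by simp
    \<comment> \<open>With \<open>h a (- a) = 1\<close>, this factorization carries the relation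
      from \<open>1 / a\<close>, whose valuation is positive, over to \<open>a\<close>.\<close>
    moreover have "1 - 1 / a = (1 - a) * (1 / - a)" using a(1) by (simp add: field_simps)
    moreover have "h a ((1 - a) * (1 / - a)) = h a (1 - a) * h a (- a)"
      using mult_right[of a "1 - a" "1 / - a"] inverse_right[of a "- a"] a by simp
    ultimately show ?thesis using neg[OF a(1)] by simp
  qed
  show ?thesis
  proof
    fix a :: rat
    assume a: "a \<noteq> 0" "a \<noteq> 1"
    then show "h a (1 - a) = 1"
      using nonneg[of a] inv[of a] inv[of "1 - a"] commute[of a "1 - a"]
      by (cases "val p a < 0"; cases "val p (1 - a) < 0") auto
  qed
qed

end

section \<open>Odd primes\<close>

text \<open>Euler's criterion gives the congruence modulo \<open>p\<close>. Both sides lie between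
  -1 and 1, so they differ by at most 2, which is less than \<open>p\<close>.\<close>

lemma Legendre_mult:
  assumes "prime p" "2 < p"
  shows "Legendre (a * b) (int p) = Legendre a (int p) * Legendre b (int p)"
proof -
  have "[Legendre (a * b) p = Legendre a p * Legendre b p] (mod int p)"
    using euler_criterion[OF assms, of "a * b"]
      cong_mult[OF euler_criterion[OF assms, of a] euler_criterion[OF assms, of b]]
    by (metis cong_sym cong_trans power_mult_distrib)
  then have "int p dvd Legendre (a * b) p - Legendre a p * Legendre b p"
    by (simp add: cong_iff_dvd_diff)
  moreover have "\<bar>Legendre (a * b) p - Legendre a p * Legendre b p\<bar> < int p"
    using assms(2) by (auto simp: Legendre_def)
  ultimately have "Legendre (a * b) p - Legendre a p * Legendre b p = 0"
    using dvd_imp_le_int[of "Legendre (a * b) p - Legendre a p * Legendre b p" "int p"] by linarith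
  then show ?thesis by simp
qed

text \<open>Any two integer representatives of \<open>u\<close> are congruent modulo
  \<open>p\<close>, so the choice hidden in \<open>lambda\<close> is immaterial; since
  \<open>p\<close> does not divide \<open>r\<close>, the Legendre symbol avoids its value 0.\<close>

lemma lambda_eq_Legendre:
  assumes p: "prime p" and "local_cong p (int p) u (of_int r)" "\<not> int p dvd r"
  shows "lambda p u = Legendre r (int p)"
proof -
  have "QuadRes (int p) s \<longleftrightarrow> QuadRes (int p) r" if "local_cong p (int p) u (of_int s)" for s
  proof -
    have "local_cong p (int p) (of_int s) (of_int r)"
      using local_cong_trans[OF p] local_cong_minus(2)[OF p that] assms(2) by blast
    then have "[s = r] (mod int p)"
      using local_cong_of_int_iff[OF p, of "int p" 1] by (simp add: cong_iff_dvd_diff)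
    then show ?thesis unfolding QuadRes_def using cong_trans cong_sym by meson
  qed
  then have "(\<exists>s. local_cong p (int p) u (of_int s) \<and> QuadRes (int p) s) \<longleftrightarrow> QuadRes (int p) r"
    using assms(2) by blast
  moreover have "\<not> [r = 0] (mod int p)" using assms(3) by (simp add: cong_0_iff)
  ultimately show ?thesis unfolding lambda_def Legendre_def by simp
qed

context
  fixes p :: nat
  assumes p: "prime p" and odd: "p > 2"
begin

lemma lambda_mult:
  assumes "u \<in> local_units p" "w \<in> local_units p"
  shows "lambda p (u * w) = lambda p u * lambda p w"
proof -
  obtain r where r: "local_cong p (int p) u (of_int r)" "\<not> int p dvd r"
    using local_units_representative[OF p _ _ assms(1), of "int p" 1] by auto
  obtain s where s: "local_cong p (int p) w (of_int s)" "\<not> int p dvd s"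
    using local_units_representative[OF p _ _ assms(2), of "int p" 1] by auto
  have "local_cong p (int p) (u * w) (of_int (r * s))"
    using local_cong_mult[OF p r(1) s(1)] local_units_subset[OF p assms(2)]
      of_int_in_local_ring[OF p] by simp
  moreover have "\<not> int p dvd r * s" using r s p by (simp add: prime_dvd_mult_iff)
  ultimately show ?thesis
    using lambda_eq_Legendre[OF p r] lambda_eq_Legendre[OF p s] lambda_eq_Legendre[OF p, of "u * w" "r * s"]
      Legendre_mult[OF p odd] by simp
qed

lemma lambda_eq_1_if_cong_1:
  assumes "local_cong p (int p) u 1"
  shows "lambda p u = 1"
proof -
  have "QuadRes (int p) 1" unfolding QuadRes_def by (rule exI[of _ 1]) simp
  then show ?thesis unfolding lambda_def using assms by (metis of_int_1)
qed

lemma lambda_1: "lambda p 1 = 1"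
  using lambda_eq_1_if_cong_1 local_cong_of_int_iff[OF p, of "int p" 1 1 1] by simp

lemma hilbert_symbol_odd: "hilbert_symbol (Finite_Place p) a b = lambda p (tame p a b)"
  using odd by simp

lemma steinberg_pairing_odd: "steinberg_pairing (hilbert_symbol (Finite_Place p))"
proof (rule steinberg_pairing_if_val[OF p])
  show "sign_pairing (hilbert_symbol (Finite_Place p))"
  proof
    fix a b c :: rat
    assume a: "a \<noteq> 0" and b: "b \<noteq> 0"
    show "hilbert_symbol (Finite_Place p) a b = 1 \<or> hilbert_symbol (Finite_Place p) a b = - 1"
      unfolding hilbert_symbol_odd by (simp add: lambda_def)
    have "lambda p (tame p a b) * lambda p (tame p b a) = 1"
      using lambda_mult[OF tame_in_local_units[OF p a b] tame_in_local_units[OF p b a]]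
      by (simp add: tame_mult_commute[OF p a b] lambda_1)
    then show "hilbert_symbol (Finite_Place p) a b = hilbert_symbol (Finite_Place p) b a"
      unfolding hilbert_symbol_odd by (auto simp: zmult_eq_1_iff)
    assume c: "c \<noteq> 0"
    show "hilbert_symbol (Finite_Place p) a (b * c) =
        hilbert_symbol (Finite_Place p) a b * hilbert_symbol (Finite_Place p) a c"
      unfolding hilbert_symbol_odd tame_mult_right[OF p a b c]
      by (intro lambda_mult tame_in_local_units p a b c)
  qed
next
  fix a :: rat assume "a \<noteq> 0"
  then show "hilbert_symbol (Finite_Place p) a (- a) = 1"
    unfolding hilbert_symbol_odd by (simp add: tame_minus_self[OF p] lambda_1)
next
  fix a :: rat assume a: "a \<noteq> 0" "val p a > 0"
  note * = positive_val_steinberg[OF p a]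
  have "lambda p (1 - a) = 1"
    using *(2) a(2) by (intro lambda_eq_1_if_cong_1 local_cong_dvd[OF p *(2)]) simp
  then show "hilbert_symbol (Finite_Place p) a (1 - a) = 1"
    unfolding hilbert_symbol_odd *(3)
    using multiplicative_sign_powi[OF p, of "lambda p", OF lambda_mult lambda_1 *(1)] by simp
next
  fix a :: rat assume "val p a = 0" "val p (1 - a) = 0"
  \<comment> \<open>All exponents in the tame symbol are 0.\<close>
  then show "hilbert_symbol (Finite_Place p) a (1 - a) = 1"
    unfolding hilbert_symbol_odd by (simp add: tame_def lambda_1)
qed

text \<open>As \<open>b\<close> has valuation 1 and \<open>a\<close> is a unit, the tame symbol is
  \<open>a\<close> itself. This turns the local hypothesis into a congruence for the
  descent.\<close>

lemma QuadRes_if_hilbert_symbol_eq_1: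
  assumes "\<not> int p dvd a" "int p dvd b" "\<not> (int p)\<^sup>2 dvd b"
    and "hilbert_symbol (Finite_Place p) (of_int a) (of_int b) = 1"
  shows "QuadRes (int p) a"
proof -
  have u: "of_int a \<in> local_units p" using assms(1) by (rule of_int_in_local_units[OF p])
  obtain c where c: "b = int p * c" using assms(2) by blast
  then have "\<not> int p dvd c" using assms(3) by (auto simp: power2_eq_square)
  then have w: "of_int c \<in> local_units p" by (rule of_int_in_local_units[OF p])
  have "val p (of_int b) = 1" using val_unit_part_eqI(1)[OF p w, of "of_int b" 1] c by simp
  then have "tame p (of_int a) (of_int b) = of_int a"
    by (simp add: tame_def val_unit_part_local_unit[OF p u])
  then have "lambda p (of_int a) = 1" using assms(4) hilbert_symbol_odd by simp
  moreover have "local_cong p (int p) (of_int a) (of_int a)"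
    using local_cong_of_int_iff[OF p, of "int p" 1] by simp
  ultimately have "Legendre a (int p) = 1" using lambda_eq_Legendre[OF p] assms(1) by simp
  then show ?thesis unfolding Legendre_def by (auto split: if_splits)
qed

end

section \<open>The prime 2\<close>

lemma local_cong_2_representative_iff:
  assumes "local_cong 2 8 u (of_int r)"
  shows "local_cong 2 8 u (of_int s) \<longleftrightarrow> 8 dvd r - s" "local_cong 2 4 u (of_int s) \<longleftrightarrow> 4 dvd r - s"
proof -
  note [intro] = local_cong_trans[OF two_is_prime_nat] local_cong_minus(2)[OF two_is_prime_nat]
  have "local_cong 2 8 u (of_int s) \<longleftrightarrow> local_cong 2 8 (of_int r) (of_int s)"
    using assms by blast
  then show "local_cong 2 8 u (of_int s) \<longleftrightarrow> 8 dvd r - s"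
    using local_cong_of_int_iff[OF two_is_prime_nat, of 8 3 r s] by simp
  have "local_cong 2 4 u (of_int r)"
    using local_cong_dvd[OF two_is_prime_nat assms, of 4] by simp
  then have "local_cong 2 4 u (of_int s) \<longleftrightarrow> local_cong 2 4 (of_int r) (of_int s)"
    by blast
  then show "local_cong 2 4 u (of_int s) \<longleftrightarrow> 4 dvd r - s"
    using local_cong_of_int_iff[OF two_is_prime_nat, of 4 2 r s] by simp
qed

text \<open>Reads both functions off an integer residue modulo 8, so that their laws at 2 become
  finite checks over 1, 3, 5 and 7.\<close>

lemma eps_eq_if_cong:
  assumes "local_cong 2 8 u (of_int r)"
  shows "eps4 u = (if 4 dvd r - 1 then 0 else 1)"
    "eps8 u = (if 8 dvd r - 1 \<or> 8 dvd r + 1 then 0 else 1)"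
  using local_cong_2_representative_iff[OF assms, of 1]
    local_cong_2_representative_iff[OF assms, of "- 1"]
  by (simp_all add: eps4_def eps8_def)

lemma local_units_2_representative:
  assumes "u \<in> local_units 2"
  obtains r where "local_cong 2 8 u (of_int r)" "r \<in> {1, 3, 5, 7}"
proof -
  obtain r where r: "local_cong 2 8 u (of_int r)" "odd r"
    using local_units_representative[OF two_is_prime_nat _ _ assms, of 8 3] by auto
  have "local_cong 2 8 u (of_int (r mod 8))"
    unfolding local_cong_2_representative_iff(1)[OF r(1)] by simp
  moreover have "r mod 8 \<in> {1, 3, 5, 7}"
    using r(2) unfolding insert_iff empty_iff by presburger
  ultimately show ?thesis using that by blast
qed

text \<open>Both functions are homomorphisms from the odd residues modulo 8 to the group of order 2,
  written here with natural numbers reduced modulo 2.\<close>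

lemma eps_mult:
  assumes "u \<in> local_units 2" "w \<in> local_units 2"
  shows "eps4 (u * w) = (eps4 u + eps4 w) mod 2" "eps8 (u * w) = (eps8 u + eps8 w) mod 2"
proof -
  obtain r where r: "local_cong 2 8 u (of_int r)" "r \<in> {1, 3, 5, 7}"
    using local_units_2_representative[OF assms(1)] .
  obtain s where s: "local_cong 2 8 w (of_int s)" "s \<in> {1, 3, 5, 7}"
    using local_units_2_representative[OF assms(2)] .
  have rs: "local_cong 2 8 (u * w) (of_int (r * s))"
    using local_cong_mult[OF two_is_prime_nat r(1) s(1)]
      local_units_subset[OF two_is_prime_nat assms(2)] of_int_in_local_ring[OF two_is_prime_nat]
    by simp
  show "eps4 (u * w) = (eps4 u + eps4 w) mod 2" "eps8 (u * w) = (eps8 u + eps8 w) mod 2"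
    unfolding eps_eq_if_cong[OF rs] eps_eq_if_cong[OF r(1)] eps_eq_if_cong[OF s(1)]
    using r(2) s(2) by auto
qed

lemma eps_1: "eps4 1 = 0" "eps8 1 = 0"
  using eps_eq_if_cong[of 1 1] local_cong_of_int_iff[OF two_is_prime_nat, of 8 3 1 1] by simp_all

text \<open>One of \<open>u\<close> and \<open>- u\<close> is congruent to 1 modulo 4.\<close>

lemma eps4_minus:
  assumes "u \<in> local_units 2"
  shows "eps4 u * eps4 (- u) = 0"
proof -
  obtain r where r: "local_cong 2 8 u (of_int r)" "r \<in> {1, 3, 5, 7}"
    using local_units_2_representative[OF assms] .
  have mr: "local_cong 2 8 (- u) (of_int (- r))"
    using local_cong_minus(1)[OF two_is_prime_nat r(1)] by simp
  show ?thesis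
    using r(2) unfolding eps_eq_if_cong(1)[OF r(1)] eps_eq_if_cong(1)[OF mr]
    by auto
qed

lemma minus_one_power_mod_2: "(- 1 :: int) ^ (n mod 2) = (- 1) ^ n"
  by (simp add: mod2_eq_if)

lemma sign_eps8_powi:
  assumes "u \<in> local_units 2"
  shows "(- 1 :: int) ^ eps8 (u powi k) = ((- 1) ^ eps8 u) ^ nat \<bar>k\<bar>"
  by (rule multiplicative_sign_powi[OF two_is_prime_nat])
    (simp_all add: assms eps_mult eps_1 minus_one_power_mod_2 power_add)

lemma hilbert_symbol_2:
  "hilbert_symbol (Finite_Place 2) a b =
    (- 1) ^ (eps4 (unit_part 2 a) * eps4 (unit_part 2 b)) * (- 1) ^ eps8 (tame 2 a b)"
  by (simp add: power_add)

lemma steinberg_pairing_2: "steinberg_pairing (hilbert_symbol (Finite_Place 2))"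
proof (rule steinberg_pairing_if_val[OF two_is_prime_nat])
  note p = two_is_prime_nat
  show "sign_pairing (hilbert_symbol (Finite_Place 2))"
  proof
    fix a b c :: rat
    assume a: "a \<noteq> 0" and b: "b \<noteq> 0"
    show "hilbert_symbol (Finite_Place 2) a b = 1 \<or> hilbert_symbol (Finite_Place 2) a b = - 1"
      by (simp add: minus_one_power_iff)
    have "(eps8 (tame 2 a b) + eps8 (tame 2 b a)) mod 2 = 0"
      using eps_mult(2)[OF tame_in_local_units[OF p a b] tame_in_local_units[OF p b a]]
      by (simp add: tame_mult_commute[OF p a b] eps_1)
    \<comment> \<open>Equal parity suffices because \<open>eps8\<close> takes only the values 0 and
      1.\<close>
    then have "eps8 (tame 2 a b) = eps8 (tame 2 b a)" by (auto simp: eps8_def split: if_splits)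
    then show "hilbert_symbol (Finite_Place 2) a b = hilbert_symbol (Finite_Place 2) b a"
      by (simp add: mult.commute)
    assume c: "c \<noteq> 0"
    define e where "e = eps4 (unit_part 2 a)"
    have "(- 1 :: int) ^ (e * ((eps4 (unit_part 2 b) + eps4 (unit_part 2 c)) mod 2)) =
      (- 1) ^ (e * eps4 (unit_part 2 b)) * (- 1) ^ (e * eps4 (unit_part 2 c))"
      by (simp add: eps4_def)
    then show "hilbert_symbol (Finite_Place 2) a (b * c) =
        hilbert_symbol (Finite_Place 2) a b * hilbert_symbol (Finite_Place 2) a c"
      unfolding hilbert_symbol_2 tame_mult_right[OF p a b c] val_unit_part_mult(2)[OF p b c]
      using eps_mult(1)[OF val_unit_part(1)[OF p b] val_unit_part(1)[OF p c]]
        eps_mult(2)[OF tame_in_local_units[OF p a b] tame_in_local_units[OF p a c]]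
      by (simp add: e_def minus_one_power_mod_2 power_add mult_ac)
  qed
next
  fix a :: rat assume a: "a \<noteq> 0"
  show "hilbert_symbol (Finite_Place 2) a (- a) = 1"
    unfolding hilbert_symbol_2 val_unit_part_minus(2)[OF two_is_prime_nat a]
      eps4_minus[OF val_unit_part(1)[OF two_is_prime_nat a]] tame_minus_self[OF two_is_prime_nat a]
    by (simp add: eps_1)
next
  fix a :: rat assume a: "a \<noteq> 0" "val 2 a > 0"
  note p = two_is_prime_nat
  note * = positive_val_steinberg[OF p a]
  define k where "k = nat (val 2 a)"
  have k: "val 2 a = int k" "k > 0" using a by (auto simp: k_def)
  have up: "unit_part 2 (1 - a) = 1 - a" using val_unit_part_local_unit[OF p *(1)] by simp
  obtain r where r: "local_cong 2 8 (unit_part 2 a) (of_int r)" "r \<in> {1, 3, 5, 7}"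
    using local_units_2_representative[OF val_unit_part(1)[OF p a(1)]] .
  \<comment> \<open>Here \<open>a\<close> is \<open>2 ^ k\<close> times its unit part, which may be
    replaced by \<open>r\<close> modulo 8.\<close>
  have "local_cong 2 8 (1 - a) (of_int (1 - 2 ^ k * r))"
  proof -
    obtain z where z: "z \<in> local_ring 2" "unit_part 2 a - of_int r = 8 * z"
      using r(1) unfolding local_cong_def by auto
    have "(1 - a) - of_int (1 - 2 ^ k * r) = - (2 ^ k) * (unit_part 2 a - of_int r)"
      using val_unit_part(2)[OF p a(1)] k(1) by (simp add: algebra_simps)
    also have "\<dots> = of_int 8 * (of_int (- (2 ^ k)) * z)" using z(2) by simp
    finally show ?thesis
      unfolding local_cong_def using local_ring_mult[OF p of_int_in_local_ring[OF p] z(1)] by blast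
  qed
  note e = eps_eq_if_cong[OF this] eps_eq_if_cong(1)[OF r(1)]
  \<comment> \<open>For \<open>k = 1\<close> both factors are -1 exactly when \<open>r\<close> is 3
    or 7. For \<open>k = 2\<close> the residue is 5 modulo 8: \<open>eps4\<close> vanishes and the
    other sign is squared. For \<open>k \<ge> 3\<close> it is 1 modulo 8.\<close>
  have "(- 1 :: int) ^ (eps4 (unit_part 2 a) * eps4 (1 - a)) * ((- 1) ^ eps8 (1 - a)) ^ k = 1"
  proof -
    have "k = 1 \<or> k = 2 \<or> k = 3 + (k - 3)" using k(2) by linarith
    then consider "k = 1" | "k = 2" | l where "k = 3 + l" by blast
    then show ?thesis
    proof cases
      case 1
      then show ?thesis using r(2) unfolding e by auto
    next
      case 2
      then show ?thesis using r(2) unfolding e by auto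
    next
      case 3
      have "8 dvd 1 - 2 ^ k * r - 1" "4 dvd 1 - 2 ^ k * r - 1"
        unfolding 3 by (simp_all add: power_add mult.assoc)
      then show ?thesis unfolding e by simp
    qed
  qed
  then show "hilbert_symbol (Finite_Place 2) a (1 - a) = 1"
    unfolding hilbert_symbol_2 up *(3) sign_eps8_powi[OF *(1)] by (simp add: k(1))
next
  \<comment> \<open>This case is empty: two units at 2 have odd residues and cannot add up to
    1.\<close>
  fix a :: rat assume a: "a \<noteq> 0" "a \<noteq> 1" "val 2 a = 0" "val 2 (1 - a) = 0"
  note p = two_is_prime_nat
  have "a \<in> local_units 2" "1 - a \<in> local_units 2"
    using val_unit_part[OF p, of a] val_unit_part[OF p, of "1 - a"] a by simp_all
  then obtain r s where r: "local_cong 2 8 a (of_int r)" "r \<in> {1, 3, 5, 7}"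
    and s: "local_cong 2 8 (1 - a) (of_int s)" "s \<in> {1, 3, 5, 7}"
    by (meson local_units_2_representative)
  obtain z z' where z: "z \<in> local_ring 2" "a - of_int r = of_int 8 * z"
    "z' \<in> local_ring 2" "(1 - a) - of_int s = of_int 8 * z'"
    using r(1) s(1) unfolding local_cong_def by blast
  then have "of_int 1 - of_int (r + s) = of_int 8 * (z + z')" by (simp add: algebra_simps)
  then have "local_cong 2 8 (of_int 1) (of_int (r + s))"
    unfolding local_cong_def using z local_ring_add[OF p] by blast
  then have "8 dvd 1 - (r + s)" using local_cong_of_int_iff[OF p, of 8 3 1 "r + s"] by simp
  with r(2) s(2) have False by auto
  then show "hilbert_symbol (Finite_Place 2) a (1 - a) = 1" ..
qed

section \<open>Descent\<close>

text \<open>In the Steinberg relation, \<open>a\<close> and \<open>1 - a\<close> are never both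
  negative.\<close>

lemma steinberg_pairing_infinite: "steinberg_pairing (hilbert_symbol Infinite_Place)"
  by unfold_locales (auto simp: zero_less_mult_iff not_less)

lemma steinberg_pairing_hilbert_symbol:
  assumes "v \<in> places_rat"
  shows "steinberg_pairing (hilbert_symbol v)"
proof -
  have "steinberg_pairing (hilbert_symbol (Finite_Place p))" if "prime p" for p
    using that steinberg_pairing_2 steinberg_pairing_odd[of p] prime_ge_2_nat[of p]
    by (cases "p = 2") auto
  then show ?thesis using assms steinberg_pairing_infinite by (auto simp: places_rat_def)
qed

text \<open>Squarefreeness makes each prime factor coprime to the remaining cofactor, so the square
  roots are glued by the Chinese remainder theorem.\<close>

lemma square_mod_squarefree:
  fixes n a :: int
  assumes "squarefree n" "\<And>p. prime p \<Longrightarrow> p dvd n \<Longrightarrow> QuadRes p a"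
  shows "QuadRes n a"
  using assms
proof (induction n rule: prime_divisors_induct)
  case zero
  then show ?case by simp
next
  case (unit x)
  then show ?case
    unfolding QuadRes_def cong_iff_dvd_diff using unit_imp_dvd by blast
next
  case (factor q x)
  have "squarefree x" using factor.prems(1) squarefree_multD by blast
  then obtain s where s: "[s\<^sup>2 = a] (mod x)"
    using factor.IH factor.prems(2) unfolding QuadRes_def by (meson dvd_mult)
  obtain t where t: "[t\<^sup>2 = a] (mod q)"
    using factor.prems(2)[of q] factor.hyps unfolding QuadRes_def by auto
  have "\<not> q dvd x"
    using squarefreeD[OF factor.prems(1), of q] factor.hyps
    by (auto simp: power2_eq_square not_prime_unit)
  then have cop: "coprime q x" using factor.hyps prime_imp_coprime by blast
  then obtain y where y: "[y = t] (mod q)" "[y = s] (mod x)"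
    using binary_chinese_remainder_int by blast
  have "[y\<^sup>2 = a] (mod q)" "[y\<^sup>2 = a] (mod x)"
    using y s t cong_pow cong_trans by blast+
  then have "[y\<^sup>2 = a] (mod q * x)"
    using cop by (simp add: cong_iff_dvd_diff divides_mult)
  then show ?case unfolding QuadRes_def by blast
qed

lemma small_square_root_mod:
  fixes n a :: int
  assumes "QuadRes n a" "n \<noteq> 0"
  obtains t where "n dvd t\<^sup>2 - a" "2 * \<bar>t\<bar> \<le> \<bar>n\<bar>"
proof -
  obtain y where y: "n dvd y\<^sup>2 - a" using assms(1) unfolding QuadRes_def cong_iff_dvd_diff by blast
  \<comment> \<open>The shift by half of \<open>\<bar>n\<bar>\<close> moves the residue of
    \<open>y\<close> into an interval centred near 0; rounding down keeps the bound for both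
    parities.\<close>
  define t where "t = (y + \<bar>n\<bar> div 2) mod \<bar>n\<bar> - \<bar>n\<bar> div 2"
  have "0 \<le> (y + \<bar>n\<bar> div 2) mod \<bar>n\<bar>" "(y + \<bar>n\<bar> div 2) mod \<bar>n\<bar> < \<bar>n\<bar>" using assms(2) by auto
  moreover have "2 * (\<bar>n\<bar> div 2) \<le> \<bar>n\<bar>" "\<bar>n\<bar> \<le> 2 * (\<bar>n\<bar> div 2) + 1" by presburger+
  moreover have "2 * \<bar>w - h\<bar> \<le> m" if "0 \<le> w" "w < m" "2 * h \<le> m" "m \<le> 2 * h + 1" for w h m :: int
    using that by (auto simp: abs_if)
  ultimately have "2 * \<bar>t\<bar> \<le> \<bar>n\<bar>" unfolding t_def by blast
  have "t - y = - (\<bar>n\<bar> * ((y + \<bar>n\<bar> div 2) div \<bar>n\<bar>))"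
    unfolding t_def by (simp add: minus_div_mult_eq_mod [symmetric] algebra_simps)
  then have "n dvd t - y" by simp
  then have "n dvd (t - y) * (t + y) + (y\<^sup>2 - a)" using y by (intro dvd_add) auto
  then have "n dvd t\<^sup>2 - a" by (simp add: power2_eq_square algebra_simps)
  then show ?thesis using that \<open>2 * \<bar>t\<bar> \<le> \<bar>n\<bar>\<close> by blast
qed

section \<open>Pairs whose symbols are all trivial\<close>

definition all_hilbert_one :: "rat \<Rightarrow> rat \<Rightarrow> bool" where
  "all_hilbert_one a b \<longleftrightarrow> (\<forall>v \<in> places_rat. hilbert_symbol v a b = 1)"

lemma all_hilbert_one_commute:
  assumes "a \<noteq> 0" "b \<noteq> 0"
  shows "all_hilbert_one a b \<longleftrightarrow> all_hilbert_one b a"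
proof -
  have "hilbert_symbol v a b = hilbert_symbol v b a" if "v \<in> places_rat" for v
  proof -
    interpret steinberg_pairing "hilbert_symbol v"
      using that by (rule steinberg_pairing_hilbert_symbol)
    show ?thesis using assms by (rule commute)
  qed
  then show ?thesis by (simp add: all_hilbert_one_def)
qed

lemma all_hilbert_one_mult_square:
  assumes "a \<noteq> 0" "b \<noteq> 0" "c \<noteq> 0"
  shows "all_hilbert_one a (b * c\<^sup>2) \<longleftrightarrow> all_hilbert_one a b"
proof -
  have "hilbert_symbol v a (b * c\<^sup>2) = hilbert_symbol v a b" if "v \<in> places_rat" for v
  proof -
    interpret steinberg_pairing "hilbert_symbol v"
      using that by (rule steinberg_pairing_hilbert_symbol)
    show ?thesis using assms by (rule mult_square_right)
  qed
  then show ?thesis by (simp add: all_hilbert_one_def)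
qed

text \<open>The counterpart of \<open>represents_one_cancel\<close> for the symbols: it passes the
  hypothesis down to \<open>c\<close>, while the other passes a solution back up.\<close>

lemma all_hilbert_one_cancel:
  assumes "a \<noteq> 0" "b \<noteq> 0" "c \<noteq> 0" "b * c = s\<^sup>2 - a * t\<^sup>2" "all_hilbert_one a b"
  shows "all_hilbert_one a c"
proof -
  have "hilbert_symbol v a c = hilbert_symbol v a b" if "v \<in> places_rat" for v
  proof -
    interpret steinberg_pairing "hilbert_symbol v"
      using that by (rule steinberg_pairing_hilbert_symbol)
    show ?thesis using assms(1-4) by (rule cancel_norm_form)
  qed
  then show ?thesis using assms(5) by (simp add: all_hilbert_one_def)
qed

text \<open>Modulo 2 and modulo primes dividing \<open>a\<close>, the residue of \<open>a\<close> is
  0 or 1, hence a square. Only the odd primes not dividing \<open>a\<close> use the symbol.\<close>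

lemma QuadRes_if_all_hilbert_one:
  fixes a b :: int
  assumes "squarefree b" "all_hilbert_one (of_int a) (of_int b)"
  shows "QuadRes b a"
proof (rule square_mod_squarefree[OF assms(1)])
  fix q :: int
  assume q: "prime q" "q dvd b"
  define p where "p = nat q"
  have p: "q = int p" "prime p" using q(1) prime_ge_0_int[OF q(1)] by (auto simp: p_def)
  show "QuadRes q a"
  proof (cases "q dvd a")
    case True
    then have "[0\<^sup>2 = a] (mod q)" by (simp add: cong_iff_dvd_diff)
    then show ?thesis unfolding QuadRes_def by blast
  next
    case False
    show ?thesis
    proof (cases "p = 2")
      case True
      then have "[1\<^sup>2 = a] (mod q)"
        using False p(1) by (simp add: cong_iff_dvd_diff)
      then show ?thesis unfolding QuadRes_def by blast
    next
      case odd: False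
      have "\<not> q\<^sup>2 dvd b" using squarefreeD[OF assms(1), of q] q(1) not_prime_unit by blast
      moreover have "hilbert_symbol (Finite_Place p) (of_int a) (of_int b) = 1"
        using assms(2) p(2) unfolding all_hilbert_one_def places_rat_def by blast
      moreover have "p > 2" using odd prime_ge_2_nat[OF p(2)] by simp
      ultimately show ?thesis
        using QuadRes_if_hilbert_symbol_eq_1[of p a b] False q p by simp
    qed
  qed
qed

text \<open>The induction hypothesis appears as a premise with \<open>a\<close> fixed, so the step
  serves both orders of the pair. A square factor of \<open>b\<close> is stripped first; otherwise,
  unless \<open>\<bar>b\<bar> = 1\<close>, the cofactor \<open>c\<close> replaces
  \<open>b\<close>.\<close>

lemma represents_one_descent_step:
  fixes a b :: int
  assumes nz: "a \<noteq> 0" "b \<noteq> 0" and le: "\<bar>a\<bar> \<le> \<bar>b\<bar>"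
    and all: "all_hilbert_one (of_int a) (of_int b)"
    and IH: "\<And>c :: int. c \<noteq> 0 \<Longrightarrow> \<bar>c\<bar> < \<bar>b\<bar> \<Longrightarrow> all_hilbert_one (of_int a) (of_int c) \<Longrightarrow>
      \<exists>x y :: rat. of_int a * x\<^sup>2 + of_int c * y\<^sup>2 = 1"
  shows "\<exists>x y :: rat. of_int a * x\<^sup>2 + of_int b * y\<^sup>2 = 1"
proof -
  consider "\<not> squarefree b" | "\<bar>b\<bar> = 1" | "squarefree b" "\<bar>b\<bar> \<ge> 2" using nz by linarith
  then show ?thesis
  proof cases
    case 1
    then obtain d where d: "d\<^sup>2 dvd b" "\<not> is_unit d" by (rule not_squarefreeE)
    then obtain c where c: "b = c * d\<^sup>2" by (metis dvd_def mult.commute)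
    then have "c \<noteq> 0" "d \<noteq> 0" using nz by auto
    have "\<bar>d\<bar> > 1" using d(2) \<open>d \<noteq> 0\<close> by (simp add: zdvd1_eq)
    then have "d\<^sup>2 > 1" using one_less_power[of "\<bar>d\<bar>" 2] by simp
    then have "\<bar>c\<bar> < \<bar>b\<bar>" using \<open>c \<noteq> 0\<close> c by (simp add: abs_mult)
    moreover have b: "of_int b = (of_int c * (of_int d)\<^sup>2 :: rat)" using c by simp
    then have "all_hilbert_one (of_int a) (of_int c)"
      using all all_hilbert_one_mult_square[of "of_int a" "of_int c" "of_int d"] nz \<open>c \<noteq> 0\<close> \<open>d \<noteq> 0\<close>
      by simp
    ultimately have "\<exists>x y :: rat. of_int a * x\<^sup>2 + of_int c * y\<^sup>2 = 1" using IH \<open>c \<noteq> 0\<close> by blast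
    then show ?thesis
      unfolding b using represents_one_square_factor \<open>d \<noteq> 0\<close> of_int_eq_0_iff by blast
  next
    case 2
    have "hilbert_symbol Infinite_Place (of_int a) (of_int b) = 1"
      using all unfolding all_hilbert_one_def places_rat_def by blast
    then have "a > 0 \<or> b > 0" by (auto split: if_splits)
    \<comment> \<open>Both numbers are 1 or -1, because
      \<open>\<bar>a\<bar> \<le> \<bar>b\<bar> = 1\<close>.\<close>
    then consider "a = 1" | "b = 1" using 2 le nz by linarith
    then show ?thesis
    proof cases
      case 1
      then show ?thesis by (intro exI[of _ 1] exI[of _ 0]) simp
    next
      case 2
      then show ?thesis by (intro exI[of _ 0] exI[of _ 1]) simp
    qed
  next
    case 3
    obtain t where t: "b dvd t\<^sup>2 - a" "2 * \<bar>t\<bar> \<le> \<bar>b\<bar>"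
      using small_square_root_mod[OF QuadRes_if_all_hilbert_one[OF 3(1) all] nz(2)] .
    obtain c where c: "t\<^sup>2 - a = b * c" using t(1) by blast
    have bc: "of_int b * of_int c = (of_int t)\<^sup>2 - (of_int a :: rat) * 1\<^sup>2"
      using arg_cong[OF c, of "of_int :: int \<Rightarrow> rat"] by simp
    show ?thesis
    proof (cases "c = 0")
      case True
      then have "a = t\<^sup>2" using c by simp
      then have "of_int a * (1 / of_int t)\<^sup>2 + of_int b * 0\<^sup>2 = (1 :: rat)"
        using nz(1) by (simp add: power_divide)
      then show ?thesis by blast
    next
      case False
      \<comment> \<open>The bounds on \<open>t\<close> and \<open>a\<close> give
        \<open>4 * \<bar>c\<bar> \<le> \<bar>b\<bar> + 4\<close>, which is less than
        \<open>4 * \<bar>b\<bar>\<close> as soon as \<open>\<bar>b\<bar> \<ge> 2\<close>.\<close>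
      have "\<bar>c\<bar> < \<bar>b\<bar>"
      proof -
        have "4 * t\<^sup>2 \<le> \<bar>b\<bar>\<^sup>2"
          using power_mono[OF t(2), of 2] by (simp add: power_mult_distrib)
        moreover have "\<bar>b\<bar> * \<bar>c\<bar> \<le> t\<^sup>2 + \<bar>a\<bar>"
          using abs_triangle_ineq4[of "t\<^sup>2" a] c by (simp add: abs_mult)
        ultimately have "4 * (\<bar>b\<bar> * \<bar>c\<bar>) \<le> \<bar>b\<bar> * (\<bar>b\<bar> + 4)"
          using le by (simp add: power2_eq_square algebra_simps)
        then have "\<bar>b\<bar> * (4 * \<bar>c\<bar>) \<le> \<bar>b\<bar> * (\<bar>b\<bar> + 4)" by (simp add: mult_ac)
        then have "4 * \<bar>c\<bar> \<le> \<bar>b\<bar> + 4" using nz(2) by (simp add: mult_le_cancel_left)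
        then show ?thesis using 3(2) by linarith
      qed
      moreover have "all_hilbert_one (of_int a) (of_int c)"
        using all_hilbert_one_cancel[OF _ _ _ bc all] nz False by simp
      ultimately have "\<exists>x y :: rat. of_int a * x\<^sup>2 + of_int c * y\<^sup>2 = 1" using IH False by blast
      \<comment> \<open>The roles of \<open>b\<close> and \<open>c\<close> are exchanged in order to
        return from a solution for \<open>c\<close> to one for \<open>b\<close>.\<close>
      moreover have "of_int c * of_int b = (of_int t)\<^sup>2 - (of_int a :: rat) * 1\<^sup>2"
        using bc by (simp add: mult.commute)
      ultimately show ?thesis
        using represents_one_cancel[of "of_int a" "of_int c" "of_int b" "of_int t" 1] nz False by simp
    qed
  qed
qed

text \<open>Induction on \<open>\<bar>a\<bar> + \<bar>b\<bar>\<close>; the pair is swapped when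
  needed so that the descent always shrinks the larger entry.\<close>

lemma represents_one_if_all_hilbert_one_int:
  fixes a b :: int
  assumes "a \<noteq> 0" "b \<noteq> 0" "all_hilbert_one (of_int a) (of_int b)"
  shows "\<exists>x y :: rat. of_int a * x\<^sup>2 + of_int b * y\<^sup>2 = 1"
  using assms
proof (induction "nat (\<bar>a\<bar> + \<bar>b\<bar>)" arbitrary: a b rule: less_induct)
  case less
  show ?case
  proof (cases "\<bar>a\<bar> \<le> \<bar>b\<bar>")
    case True
    show ?thesis
    proof (rule represents_one_descent_step[OF less.prems(1,2) True less.prems(3)])
      fix c :: int
      assume "c \<noteq> 0" "\<bar>c\<bar> < \<bar>b\<bar>" "all_hilbert_one (of_int a) (of_int c)"
      then show "\<exists>x y :: rat. of_int a * x\<^sup>2 + of_int c * y\<^sup>2 = 1"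
        using less.hyps[of a c] less.prems(1) by simp
    qed
  next
    case False
    have "\<exists>x y :: rat. of_int b * x\<^sup>2 + of_int a * y\<^sup>2 = 1"
    proof (rule represents_one_descent_step[OF less.prems(2,1)])
      show "all_hilbert_one (of_int b) (of_int a)"
        using all_hilbert_one_commute less.prems by simp
      fix c :: int
      assume "c \<noteq> 0" "\<bar>c\<bar> < \<bar>a\<bar>" "all_hilbert_one (of_int b) (of_int c)"
      then show "\<exists>x y :: rat. of_int b * x\<^sup>2 + of_int c * y\<^sup>2 = 1"
        using less.hyps[of b c] less.prems(2) by simp
    qed (use False in simp)
    then show ?thesis by (rule represents_one_swap)
  qed
qed

section \<open>From rational to integer coefficients\<close>

lemma rat_times_square_eq_int:
  fixes a :: rat
  assumes "a \<noteq> 0"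
  obtains m n :: int where "n \<noteq> 0" "m \<noteq> 0" "a = of_int m * (1 / of_int n)\<^sup>2"
proof -
  obtain k n :: int where a: "a = of_int k / of_int n" "n \<noteq> 0"
    by (metis Fract_of_int_quotient Rat_cases less_irrefl)
  then have "a = of_int (k * n) * (1 / of_int n)\<^sup>2" by (simp add: power2_eq_square)
  moreover have "k * n \<noteq> 0" using a assms by auto
  ultimately show ?thesis using that a(2) by blast
qed

text \<open>Each coefficient is an integer up to a square. Square factors are handled only in the
  second argument, so the pair is swapped between the two reductions and again on the way
  back.\<close>

lemma represents_one_if_all_hilbert_one:
  fixes a b :: rat
  assumes nz: "a \<noteq> 0" "b \<noteq> 0" and all: "all_hilbert_one a b"
  shows "\<exists>x y. a * x\<^sup>2 + b * y\<^sup>2 = 1"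
proof -
  obtain m n :: int where m: "n \<noteq> 0" "m \<noteq> 0" "a = of_int m * (1 / of_int n)\<^sup>2"
    using nz(1) by (rule rat_times_square_eq_int)
  obtain k l :: int where k: "l \<noteq> 0" "k \<noteq> 0" "b = of_int k * (1 / of_int l)\<^sup>2"
    using nz(2) by (rule rat_times_square_eq_int)
  have nz': "(of_int m :: rat) \<noteq> 0" "(of_int k :: rat) \<noteq> 0" "1 / (of_int n :: rat) \<noteq> 0"
    "1 / (of_int l :: rat) \<noteq> 0" using m k by auto
  have "all_hilbert_one a (of_int k)"
    using all all_hilbert_one_mult_square[OF nz(1) nz'(2,4)] unfolding k(3) by blast
  then have "all_hilbert_one (of_int k) a" using all_hilbert_one_commute[OF nz(1) nz'(2)] by blast
  then have "all_hilbert_one (of_int k) (of_int m)"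
    using all_hilbert_one_mult_square[OF nz'(2,1,3)] unfolding m(3) by blast
  then have "\<exists>x y :: rat. of_int k * x\<^sup>2 + of_int m * y\<^sup>2 = 1"
    using represents_one_if_all_hilbert_one_int m k by blast
  then have "\<exists>x y. of_int k * x\<^sup>2 + a * y\<^sup>2 = 1"
    unfolding m(3) by (rule represents_one_square_factor[OF nz'(3)])
  then have "\<exists>x y. a * x\<^sup>2 + of_int k * y\<^sup>2 = 1" by (rule represents_one_swap)
  then show ?thesis unfolding k(3) by (rule represents_one_square_factor[OF nz'(4)])
qed

theorem mainTheorem7:
  fixes a b :: rat
  assumes "a \<noteq> 0" and "b \<noteq> 0"
  shows "(\<exists>x y :: rat. a * x\<^sup>2 + b * y\<^sup>2 = 1) \<longleftrightarrow> (\<forall>v \<in> places_rat. hilbert_symbol v a b = 1)"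
proof
  assume "\<exists>x y :: rat. a * x\<^sup>2 + b * y\<^sup>2 = 1"
  then show "\<forall>v \<in> places_rat. hilbert_symbol v a b = 1"
    using assms steinberg_pairing.one_if_represents_one[OF steinberg_pairing_hilbert_symbol] by blast
next
  assume "\<forall>v \<in> places_rat. hilbert_symbol v a b = 1"
  then show "\<exists>x y :: rat. a * x\<^sup>2 + b * y\<^sup>2 = 1"
    using represents_one_if_all_hilbert_one[OF assms] unfolding all_hilbert_one_def by blast
qed

end
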